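(* Let $G$ be a finite simple connected graph and let $n$ be a positive integer. If $|C(G)|<\binom{n}{3}$, then $\max(\chi(G),h(G))<n$.
   Context: All graphs are finite and simple. $C(G)$ denotes the set of all induced cycles in $G$ (induced subgraphs of $G$ that are cycles, of length at least 3). $\chi(G)$ is the chromatic number, and the Hadwiger number $h(G)$ is the maximum $t$ such that the complete graph $K^{t}$ is a minor of $G$. *)

theory Defs
  imports "Graph_Theory.Graph_Theory" "HOL-Library.Disjoint_Sets"
begin

text \<open>
  A finite simple graph is a \<^locale>\<open>pair_graph\<close>: a finite vertex set together with a symmetric,
  loop-free set of ordered pairs, each undirected edge being represented by its two orientations.
\<close>

text \<open>
  Since \<^const>\<open>pre_digraph.cycle\<close> also accepts the closed walk along one edge and back,
  the length bound is what makes this the notion of a cycle in an undirected graph.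
\<close>

definition is_cycle_graph :: "'a pair_pre_digraph \<Rightarrow> bool" where
  "is_cycle_graph C \<longleftrightarrow>
     (\<exists>p. pre_digraph.cycle (with_proj C) p \<and> 3 \<le> length p \<and>
          pverts C = fst ` set p \<and> parcs C = set p \<union> (set p)\<inverse>)"

definition induced_cycles :: "'a pair_pre_digraph \<Rightarrow> 'a pair_pre_digraph set" where
  "induced_cycles G = {C. induced_subgraph (with_proj C) (with_proj G) \<and> is_cycle_graph C}"

definition colorable :: "'a pair_pre_digraph \<Rightarrow> nat \<Rightarrow> bool" where
  "colorable G k \<longleftrightarrow>
     (\<exists>c :: 'a \<Rightarrow> nat. c ` pverts G \<subseteq> {..<k} \<and> (\<forall>(u, v) \<in> parcs G. c u \<noteq> c v))"

definition chromatic_number :: "'a pair_pre_digraph \<Rightarrow> nat" where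
  "chromatic_number G = (LEAST k. colorable G k)"

text \<open>
  \<open>H\<close> is a minor of \<open>G\<close> if \<open>G\<close> contains pairwise disjoint connected branch sets, one for each
  vertex of \<open>H\<close>, with an edge of \<open>G\<close> between the branch sets of any two adjacent vertices of \<open>H\<close>.
  Branch sets are nonempty because \<^const>\<open>connected\<close> excludes the null graph.
\<close>

definition minor_of :: "'b pair_pre_digraph \<Rightarrow> 'a pair_pre_digraph \<Rightarrow> bool" where
  "minor_of H G \<longleftrightarrow>
     (\<exists>B :: 'b \<Rightarrow> 'a set.
        (\<forall>x \<in> pverts H. B x \<subseteq> pverts G \<and> connected (with_proj G \<restriction> B x)) \<and>
        disjoint_family_on B (pverts H) \<and>
        (\<forall>(x, y) \<in> parcs H. \<exists>u \<in> B x. \<exists>v \<in> B y. (u, v) \<in> parcs G))"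

definition hadwiger_number :: "'a pair_pre_digraph \<Rightarrow> nat" where
  "hadwiger_number G =
     Max {t. \<exists>K :: nat pair_pre_digraph. complete_digraph t (with_proj K) \<and> minor_of K G}"

text \<open>The sets and minima above are well behaved on finite simple graphs.\<close>

lemma (in pair_graph) finite_induced_cycles: "finite (induced_cycles G)"
proof (rule finite_subset)
  show "induced_cycles G \<subseteq>
      (\<lambda>(V, E). \<lparr>pverts = V, parcs = E\<rparr>) ` (Pow (pverts G) \<times> Pow (parcs G))"
  proof
    fix C assume "C \<in> induced_cycles G"
    then have "pverts C \<subseteq> pverts G" "parcs C \<subseteq> parcs G"
      by (auto simp: induced_cycles_def induced_subgraph_def subgraph_def)
    then show "C \<in> (\<lambda>(V, E). \<lparr>pverts = V, parcs = E\<rparr>) ` (Pow (pverts G) \<times> Pow (parcs G))"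
      by (intro image_eqI[of _ _ "(pverts C, parcs C)"]) auto
  qed
qed (simp add: pair_finite_verts pair_finite_arcs)

lemma (in pair_graph) colorable_chromatic_number: "colorable G (chromatic_number G)"
  unfolding chromatic_number_def
proof (rule LeastI)
  obtain c where c: "bij_betw c (pverts G) {..<card (pverts G)}"
    using ex_bij_betw_finite_nat[OF pair_finite_verts] by (auto simp: atLeast0LessThan)
  have "c u \<noteq> c v" if "(u, v) \<in> parcs G" for u v
    using that c pair_no_loops[of "(u, v)"] in_arcsD1[of u v] in_arcsD2[of u v]
    by (auto simp: bij_betw_def inj_on_eq_iff)
  then show "colorable G (card (pverts G))"
    using c unfolding colorable_def bij_betw_def by (intro exI[of _ c]) auto
qed

lemma (in pair_graph) hadwiger_set_nonempty:
  "0 \<in> {t. \<exists>K :: nat pair_pre_digraph. complete_digraph t (with_proj K) \<and> minor_of K G}"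
  by (auto simp: complete_digraph_pair_def minor_of_def disjoint_family_on_def
      intro!: exI[of _ "\<lparr>pverts = {}, parcs = {}\<rparr>"])

lemma (in pair_graph) hadwiger_set_finite:
  "finite {t. \<exists>K :: nat pair_pre_digraph. complete_digraph t (with_proj K) \<and> minor_of K G}"
proof (rule finite_subset)
  show "{t. \<exists>K :: nat pair_pre_digraph. complete_digraph t (with_proj K) \<and> minor_of K G}
      \<subseteq> {..card (pverts G)}"
  proof safe
    fix t and K :: "nat pair_pre_digraph"
    assume K: "complete_digraph t (with_proj K)" and "minor_of K G"
    then obtain B where B: "\<And>x. x \<in> pverts K \<Longrightarrow> B x \<subseteq> pverts G"
        "\<And>x. x \<in> pverts K \<Longrightarrow> connected (with_proj G \<restriction> B x)"
        and disj: "disjoint_family_on B (pverts K)"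
      unfolding minor_of_def by blast
    have "B x \<noteq> {}" if "x \<in> pverts K" for x
      using B(2)[OF that] by (auto simp: connected_def strongly_connected_def mk_symmetric_def)
    then have "\<forall>x \<in> pverts K. \<exists>v. v \<in> B x"
      by blast
    then obtain f where f: "\<And>x. x \<in> pverts K \<Longrightarrow> f x \<in> B x"
      by (auto dest!: bchoice)
    have "inj_on f (pverts K)"
      using f disj by (force simp: inj_on_def disjoint_family_on_def)
    moreover have "f ` pverts K \<subseteq> pverts G"
      using f B(1) by blast
    ultimately have "card (pverts K) \<le> card (pverts G)"
      using pair_finite_verts by (rule card_inj_on_le)
    then show "t \<le> card (pverts G)"
      using K by (simp add: complete_digraph_pair_def)
  qed
qed simp

end

theory Submission
  imports Defs
begin

text \<open>
  Every triple of branch sets of a \<open>K\<^sup>t\<close> minor carries an induced cycle that meets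
  precisely these three sets: shortest paths inside the branch sets are joined to a cycle. For
  the chromatic number, remove a vertex \<open>v\<close> whose deletion leaves a \<open>k\<close>-colourable graph while
  the whole graph is not \<open>k\<close>-colourable. For any two colours \<open>i\<close>, \<open>j\<close> some Kempe chain contains
  neighbours of \<open>v\<close> of both colours (otherwise switching chains would free colour \<open>i\<close> for \<open>v\<close>),
  and a shortest path in it between two such neighbours closes up through \<open>v\<close> to an induced
  cycle whose remaining vertices use exactly the colours \<open>i\<close> and \<open>j\<close>. So \<open>v\<close> lies on
  \<open>k choose 2\<close> induced cycles, and \<open>k choose 3\<close> further ones come from induction on the vertex set.
\<close>

section \<open>Induced paths\<close>

text \<open>Only arcs from an earlier to a later vertex are constrained. For a symmetric
  \<open>E\<close> this forbids every chord, which lets paths be built by prepending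
  vertices.\<close>

fun induced_path :: "'a rel \<Rightarrow> 'a list \<Rightarrow> bool" where
  "induced_path E [] = True"
| "induced_path E [x] = True"
| "induced_path E (x # y # zs) \<longleftrightarrow>
     (x, y) \<in> E \<and> x \<notin> set (y # zs) \<and> (\<forall>z \<in> set zs. (x, z) \<notin> E) \<and> induced_path E (y # zs)"

lemma induced_path_distinct: "induced_path E q \<Longrightarrow> distinct q"
  by (induction E q rule: induced_path.induct) auto

lemma induced_path_Cons: "induced_path E (x # q) \<Longrightarrow> induced_path E q"
  by (cases q) auto

lemma induced_path_appendD2: "induced_path E (p @ q) \<Longrightarrow> induced_path E q"
  by (induction p) (auto dest: induced_path_Cons)

lemma induced_path_append:
  assumes "induced_path E p" "induced_path E q" "p \<noteq> []" "q \<noteq> []"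
    and "set p \<inter> set q = {}" "E \<inter> set p \<times> set q = {(last p, hd q)}"
  shows "induced_path E (p @ q)"
  using assms
proof (induction E p rule: induced_path.induct)
  case (2 E x)
  then obtain y zs where q: "q = y # zs"
    by (cases q) auto
  have "y \<notin> set zs"
    using 2(2) induced_path_distinct q by fastforce
  moreover have "E \<inter> {x} \<times> set (y # zs) = {(x, y)}"
    using 2(6) q by simp
  then have "(x, z) \<in> E \<longleftrightarrow> z = y" if "z \<in> set (y # zs)" for z
    using that by blast
  ultimately show ?case
    using 2(2,5) q by auto
next
  case (3 E x y zs)
  \<comment> \<open>The only arc into \<open>q\<close> starts at this last vertex, so
    \<open>x\<close> has no arc into \<open>q\<close> at all.\<close>
  have "last (y # zs) \<noteq> x"
    using "3.prems"(1) by (metis induced_path.simps(3) last_in_set list.distinct(1))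
  then have "\<forall>z \<in> set q. (x, z) \<notin> E"
    using equalityD1[OF "3.prems"(6)] by auto
  moreover have "E \<inter> set (y # zs) \<times> set q = {(last (y # zs), hd q)}"
  proof -
    have "E \<inter> set (y # zs) \<times> set q = (E \<inter> set (x # y # zs) \<times> set q) \<inter> set (y # zs) \<times> set q"
      by auto
    also have "\<dots> = {(last (y # zs), hd q)} \<inter> set (y # zs) \<times> set q"
      unfolding "3.prems"(6) by simp
    also have "\<dots> = {(last (y # zs), hd q)}"
      using "3.prems"(4) last_in_set[of "y # zs"] by auto
    finally show ?thesis .
  qed
  then have "induced_path E ((y # zs) @ q)"
    using "3.prems" by (intro "3.IH") auto
  ultimately show ?case
    using "3.prems"(1,5) by auto
qed simp

text \<open>Turns the absence of chords into the arc set format that \<open>is_cycle_graph\<close>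
  asks for.\<close>

lemma induced_path_arcs:
  assumes "sym E" "irrefl E" "induced_path E q"
  shows "E \<inter> set q \<times> set q = set (zip q (tl q)) \<union> (set (zip q (tl q)))\<inverse>"
  using assms
proof (induction E q rule: induced_path.induct)
  case (2 E x)
  then show ?case by (auto simp: irrefl_def)
next
  case (3 E x y zs)
  have "(x, x) \<notin> E"
    using 3(3) by (auto simp: irrefl_def)
  moreover have "(u, v) \<in> E \<longleftrightarrow> (v, u) \<in> E" for u v
    using 3(2) by (auto dest: symD)
  ultimately have "E \<inter> set (x # y # zs) \<times> set (x # y # zs) =
      E \<inter> set (y # zs) \<times> set (y # zs) \<union> {(x, y), (y, x)}"
    using 3(4) by auto
  then show ?case
    using 3 by auto
qed auto

text \<open>Replaces the choice of a shortest path by induction along the walk: each new start is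
  either already in \<open>Y\<close>, already on the path, or prepended with a shortcut. Cutting to
  a suffix preserves the last vertex, hence also the unique meeting with \<open>Y\<close>.\<close>

lemma induced_path_from:
  assumes "(x, y) \<in> (E \<inter> W \<times> W)\<^sup>*" "x \<in> W" "y \<in> Y"
  shows "\<exists>q. q \<noteq> [] \<and> induced_path E q \<and> set q \<subseteq> W \<and> hd q = x \<and> set q \<inter> Y = {last q}"
  using assms
proof (induction rule: converse_rtrancl_induct)
  case base
  then show ?case by (intro exI[of _ "[y]"]) auto
next
  case (step x x')
  then obtain q where q: "q \<noteq> []" "induced_path E q" "set q \<subseteq> W" "hd q = x'" "set q \<inter> Y = {last q}"
    by auto
  consider "x \<in> Y" | "x \<notin> Y" "x \<in> set q" | "x \<notin> Y" "x \<notin> set q"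
    by blast
  then show ?case
  proof cases
    case 1
    then show ?thesis
      using step by (intro exI[of _ "[x]"]) auto
  next
    case 2
    then obtain ys zs where "q = ys @ x # zs"
      by (auto dest: split_list)
    then show ?thesis
      using q by (intro exI[of _ "x # zs"]) (auto dest: induced_path_appendD2)
  next
    case 3
    have "\<exists>z \<in> set q. (x, z) \<in> E"
      using q step(1) by (metis IntD1 hd_in_set)
    \<comment> \<open>Jumping to the last out-neighbour of \<open>x\<close> on \<open>q\<close>
      leaves \<open>x\<close> without chords to the rest.\<close>
    then obtain ys z zs where z: "q = ys @ z # zs" "(x, z) \<in> E" "\<forall>w \<in> set zs. (x, w) \<notin> E"
      by (elim split_list_last_propE)
    then show ?thesis
      using 3 q step by (intro exI[of _ "x # z # zs"]) (auto dest: induced_path_appendD2)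
  qed
qed

text \<open>The path from \<open>induced_path_from\<close> is cut at its last vertex in
  \<open>X\<close>; the suffix is still induced and has the same end.\<close>

lemma induced_path_between:
  assumes "(x, y) \<in> (E \<inter> W \<times> W)\<^sup>*" "x \<in> W" "x \<in> X" "y \<in> Y"
  obtains q where "q \<noteq> []" "induced_path E q" "set q \<subseteq> W"
    "set q \<inter> X = {hd q}" "set q \<inter> Y = {last q}"
proof -
  obtain q where q: "q \<noteq> []" "induced_path E q" "set q \<subseteq> W" "hd q = x" "set q \<inter> Y = {last q}"
    using induced_path_from[OF assms(1,2,4)] by blast
  then have "\<exists>z \<in> set q. z \<in> X"
    using assms(3) by (metis hd_in_set)
  then obtain ys z zs where "q = ys @ z # zs" "z \<in> X" "\<forall>w \<in> set zs. w \<notin> X"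
    by (elim split_list_last_propE)
  then show ?thesis
    using q by (intro that[of "z # zs"]) (auto dest: induced_path_appendD2)
qed

section \<open>Induced cycles\<close>

text \<open>Library walks are lists of arcs; zipping a vertex list with its shift by one gives such
  a list, closed when \<open>w = u\<close>.\<close>

lemma pcas_zip: "pcas u (zip (u # xs) (xs @ [w])) w"
  by (induction xs arbitrary: u) auto

lemma pawalk_verts_zip: "pawalk_verts u (zip (u # xs) (xs @ [w])) = u # xs @ [w]"
  by (induction xs arbitrary: u) auto

lemma zip_tl_append:
  assumes "p \<noteq> []"
  shows "zip p (tl p @ [z]) = zip p (tl p) @ [(last p, z)]"
  using assms by (induction p) (auto simp: neq_Nil_conv)

lemma arcs_between_eq:
  assumes "sym E" "Q \<subseteq> B" "P \<inter> E `` B = {u}" "Q \<inter> E `` {u} = {w}"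
  shows "E \<inter> P \<times> Q = {(u, w)}"
proof -
  have "a = u" if "a \<in> P" "b \<in> Q" "(a, b) \<in> E" for a b
    using that assms(2,3) symD[OF assms(1) that(3)] by blast
  then show ?thesis
    using assms(3,4) by blast
qed

text \<open>The map \<open>g\<close> covers all \<open>m\<close>-subsets of \<open>I\<close>. It
  will read off from a cycle the branch sets that it meets, or the colours that it uses.\<close>

lemma choose_le_card:
  assumes "finite F" "finite I"
    and "\<And>T. T \<subseteq> I \<Longrightarrow> card T = m \<Longrightarrow> \<exists>U \<in> F. g U = T"
  shows "card I choose m \<le> card F"
proof -
  have "{T. T \<subseteq> I \<and> card T = m} \<subseteq> g ` F"
    using assms(3) by blast
  from surj_card_le[OF assms(1) this] show ?thesis
    using n_subsets[OF assms(2)] by simp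
qed

context pair_graph
begin

text \<open>An induced cycle is determined by its vertex set, so vertex sets are counted. The bound
  \<open>S\<close> allows induction over vertex sets inside the fixed graph
  \<open>G\<close>.\<close>

abbreviation cycles_within :: "'a set \<Rightarrow> 'a set set" where
  "cycles_within S \<equiv> {U \<in> pverts ` induced_cycles G. U \<subseteq> S}"

lemma finite_cycles_within: "finite (cycles_within S)"
  using finite_induced_cycles by auto

lemma card_cycles_within: "card (cycles_within S) \<le> card (induced_cycles G)"
proof -
  have "card (cycles_within S) \<le> card (pverts ` induced_cycles G)"
    using finite_induced_cycles by (intro card_mono) auto
  also have "\<dots> \<le> card (induced_cycles G)"
    using finite_induced_cycles by (rule card_image_le)
  finally show ?thesis .
qed

lemma sym_parcs: "sym (parcs G)"
  by (auto intro: symI arcs_symmetric)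

lemma irrefl_parcs: "irrefl (parcs G)"
  by (auto simp: irrefl_def dest: no_loops')

text \<open>The cycle runs along \<open>p\<close>, crosses to \<open>hd q\<close>, follows
  \<open>q\<close> and returns to \<open>hd p\<close>. One of the paths may be a single vertex, in
  which case both connecting arcs share that end.\<close>

lemma induced_cycleI:
  assumes p: "induced_path (parcs G) p" "p \<noteq> []" and q: "induced_path (parcs G) q" "q \<noteq> []"
    and disj: "set p \<inter> set q = {}"
    and arcs: "parcs G \<inter> set p \<times> set q = {(last p, hd q), (hd p, last q)}"
    and sub: "set p \<union> set q \<subseteq> S" "S \<subseteq> pverts G"
    and len: "3 \<le> length p + length q"
  shows "set p \<union> set q \<in> cycles_within S"
proof -
  define U where "U = set p \<union> set q"
  define C where "C = \<lparr>pverts = U, parcs = parcs G \<inter> U \<times> U\<rparr>"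
  \<comment> \<open>The second list is \<open>p @ q\<close> rotated by one place, so each vertex is
    paired with its successor on the cycle.\<close>
  define c where "c = zip (p @ q) (tl p @ [hd q] @ tl q @ [hd p])"
  obtain u xs where u: "p @ q = u # xs"
    using p(2) by (cases "p @ q") auto
  have "xs = tl p @ q" "u = hd p"
    using u p(2) by (cases p; simp)+
  then have "tl p @ [hd q] @ tl q @ [hd p] = xs @ [u]"
    using q(2) by (cases q) auto
  then have c_zip: "c = zip (u # xs) (xs @ [u])"
    by (simp only: c_def u)
  have "c = zip p (tl p @ [hd q]) @ zip q (tl q @ [hd p])"
    unfolding c_def using p(2) q(2) by (subst append_assoc[symmetric], subst zip_append) auto
  then have c_set: "set c = set (zip p (tl p)) \<union> set (zip q (tl q)) \<union> {(last p, hd q), (last q, hd p)}"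
    using p(2) q(2) by (auto simp: zip_tl_append)
  have swap: "(v, w) \<in> parcs G \<longleftrightarrow> (w, v) \<in> parcs G" for v w
    by (auto intro: arcs_symmetric)
  have "parcs C = parcs G \<inter> set p \<times> set p \<union> parcs G \<inter> set q \<times> set q
      \<union> parcs G \<inter> set p \<times> set q \<union> (parcs G \<inter> set p \<times> set q)\<inverse>"
    using swap by (auto simp: C_def U_def)
  also have "\<dots> = set c \<union> (set c)\<inverse>"
    unfolding arcs induced_path_arcs[OF sym_parcs irrefl_parcs p(1)]
      induced_path_arcs[OF sym_parcs irrefl_parcs q(1)] c_set by auto
  finally have C_arcs: "parcs C = set c \<union> (set c)\<inverse>" .
  have "set (map fst c) = set (p @ q)"
    by (simp add: c_zip u)
  then have C_verts: "pverts C = fst ` set c"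
    by (simp add: C_def U_def)
  have "distinct (p @ q)"
    using induced_path_distinct[OF p(1)] induced_path_distinct[OF q(1)] disj by simp
  \<comment> \<open>\<open>cycle\<close> requires distinctness of the tail of the vertex sequence
    \<open>u # xs @ [u]\<close>.\<close>
  then have "distinct (xs @ [u])"
    by (simp add: u)
  moreover have "pre_digraph.awalk (with_proj C) u c u"
  proof -
    have "u \<in> pverts C"
      using arg_cong[OF u, of set] by (auto simp: C_def U_def)
    moreover have "set c \<subseteq> parcs C"
      using C_arcs by simp
    ultimately show ?thesis
      using pcas_zip[of u xs u] by (simp add: pre_digraph.awalk_def cas_with_proj_eq c_zip)
  qed
  ultimately have "pre_digraph.cycle (with_proj C) c"
    unfolding pre_digraph.cycle_def awalk_verts_with_proj_eq c_zip
    using pawalk_verts_zip[of u xs u] by (intro exI[of _ u]) auto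
  moreover have "3 \<le> length c"
    using len arg_cong[OF u, of length] by (simp add: c_zip)
  ultimately have "is_cycle_graph C"
    unfolding is_cycle_graph_def using C_verts C_arcs by blast
  moreover have "induced_subgraph (with_proj C) (with_proj G)"
  proof -
    have "wf_digraph (with_proj C)"
      by unfold_locales (auto simp: C_def)
    moreover have "wf_digraph (with_proj G)" ..
    ultimately show ?thesis
      using sub by (auto simp: induced_subgraph_def subgraph_def compatible_def C_def U_def)
  qed
  ultimately have "C \<in> induced_cycles G"
    by (simp add: induced_cycles_def)
  then have "pverts C \<in> pverts ` induced_cycles G"
    by (rule imageI)
  then show ?thesis
    using sub by (simp add: C_def U_def)
qed

section \<open>Minors\<close>

lemma connected_restrict_rtrancl:
  assumes "connected (with_proj G \<restriction> A)" "a \<in> A" "b \<in> A"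
  shows "(a, b) \<in> (parcs G \<inter> A \<times> A)\<^sup>*"
proof -
  have "a \<rightarrow>\<^sup>*\<^bsub>with_proj (mk_symmetric (with_proj G \<restriction> A))\<^esub> b"
    using assms by (auto simp: connected_def strongly_connected_def)
  then have "(a, b) \<in> rtrancl_on A (parcs (mk_symmetric (with_proj G \<restriction> A)))"
    by (simp add: reachable_def)
  \<comment> \<open>Connectedness refers to the symmetric closure, which adds no arcs here because
    \<open>G\<close> is already symmetric.\<close>
  moreover have "parcs (mk_symmetric (with_proj G \<restriction> A)) \<subseteq> parcs G \<inter> A \<times> A"
    by (auto simp: parcs_mk_symmetric intro: arcs_symmetric)
  ultimately show ?thesis
    by (metis rtrancl_on_rtranclI rtrancl_mono subsetD)
qed

lemma induced_path_in_connected: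
  assumes "connected (with_proj G \<restriction> A)" "A \<inter> X \<noteq> {}" "A \<inter> Y \<noteq> {}"
  obtains q where "q \<noteq> []" "induced_path (parcs G) q" "set q \<subseteq> A"
    "set q \<inter> X = {hd q}" "set q \<inter> Y = {last q}"
proof -
  obtain x y where "x \<in> A" "x \<in> X" "y \<in> A" "y \<in> Y"
    using assms by blast
  then show ?thesis
    using induced_path_between[OF connected_restrict_rtrancl[OF assms(1)]] that by metis
qed

text \<open>The paths \<open>p\<close>, \<open>q\<close>, \<open>r\<close> are chosen in turn. An
  end facing a set whose path is still open is the only vertex of its path with neighbours in that
  set; an end facing a path already chosen is the only neighbour of the relevant end of that path.
  Hence any two of the paths are joined by exactly one edge.\<close>

lemma induced_cycle_three_sets:
  assumes conn: "connected (with_proj G \<restriction> A)" "connected (with_proj G \<restriction> B)"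
      "connected (with_proj G \<restriction> C)"
    and disj: "A \<inter> B = {}" "A \<inter> C = {}" "B \<inter> C = {}"
    and adj: "parcs G \<inter> A \<times> B \<noteq> {}" "parcs G \<inter> A \<times> C \<noteq> {}" "parcs G \<inter> B \<times> C \<noteq> {}"
    and sub: "A \<union> B \<union> C \<subseteq> pverts G"
  obtains U where "U \<in> cycles_within (A \<union> B \<union> C)" "U \<inter> A \<noteq> {}" "U \<inter> B \<noteq> {}" "U \<inter> C \<noteq> {}"
proof -
  have swap: "(v, w) \<in> parcs G \<longleftrightarrow> (w, v) \<in> parcs G" for v w
    by (auto intro: arcs_symmetric)
  define N where "N S = parcs G `` S" for S
  have "A \<inter> N C \<noteq> {}" "A \<inter> N B \<noteq> {}"
    using adj swap unfolding N_def by blast+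
  with conn(1) obtain p where p: "p \<noteq> []" "induced_path (parcs G) p" "set p \<subseteq> A"
    "set p \<inter> N C = {hd p}" "set p \<inter> N B = {last p}"
    by (rule induced_path_in_connected)
  have "B \<inter> N {last p} \<noteq> {}" "B \<inter> N C \<noteq> {}"
    using adj swap p(5) unfolding N_def by blast+
  with conn(2) obtain q where q: "q \<noteq> []" "induced_path (parcs G) q" "set q \<subseteq> B"
    "set q \<inter> N {last p} = {hd q}" "set q \<inter> N C = {last q}"
    by (rule induced_path_in_connected)
  have "C \<inter> N {last q} \<noteq> {}" "C \<inter> N {hd p} \<noteq> {}"
    using adj swap p(4) q(5) unfolding N_def by blast+
  with conn(3) obtain r where r: "r \<noteq> []" "induced_path (parcs G) r" "set r \<subseteq> C"
    "set r \<inter> N {last q} = {hd r}" "set r \<inter> N {hd p} = {last r}"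
    by (rule induced_path_in_connected)
  have pq: "parcs G \<inter> set p \<times> set q = {(last p, hd q)}"
    using arcs_between_eq[OF sym_parcs q(3)] p(5) q(4) unfolding N_def by blast
  have pr: "parcs G \<inter> set p \<times> set r = {(hd p, last r)}"
    using arcs_between_eq[OF sym_parcs r(3)] p(4) r(5) unfolding N_def by blast
  have qr: "parcs G \<inter> set q \<times> set r = {(last q, hd r)}"
    using arcs_between_eq[OF sym_parcs r(3)] q(5) r(4) unfolding N_def by blast
  \<comment> \<open>The three paths are reduced to the two of \<open>induced_cycleI\<close> by first
    joining \<open>p\<close> and \<open>q\<close>.\<close>
  have "induced_path (parcs G) (p @ q)"
    using p q pq disj by (intro induced_path_append) auto
  moreover have "parcs G \<inter> set (p @ q) \<times> set r = {(last (p @ q), hd r), (hd (p @ q), last r)}"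
  proof -
    have "parcs G \<inter> set (p @ q) \<times> set r = parcs G \<inter> set p \<times> set r \<union> parcs G \<inter> set q \<times> set r"
      by auto
    then show ?thesis
      unfolding pr qr using p(1) q(1) by auto
  qed
  moreover have "3 \<le> length (p @ q) + length r"
    using p(1) q(1) r(1) by (cases p; cases q; cases r) auto
  moreover have "set (p @ q) \<inter> set r = {}" "set (p @ q) \<union> set r \<subseteq> A \<union> B \<union> C"
    using p(3) q(3) r(3) disj by auto
  ultimately have "set (p @ q) \<union> set r \<in> cycles_within (A \<union> B \<union> C)"
    using p(1) r sub by (intro induced_cycleI) auto
  moreover have "hd p \<in> set p" "hd q \<in> set q" "hd r \<in> set r"
    using p(1) q(1) r(1) by auto
  with p(3) q(3) r(3) have "(set (p @ q) \<union> set r) \<inter> A \<noteq> {}" "(set (p @ q) \<union> set r) \<inter> B \<noteq> {}"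
    "(set (p @ q) \<union> set r) \<inter> C \<noteq> {}"
    unfolding set_append by blast+
  ultimately show ?thesis
    by (rule that)
qed

lemma choose_hadwiger_le: "hadwiger_number G choose 3 \<le> card (induced_cycles G)"
proof -
  define t where "t = hadwiger_number G"
  have "t \<in> {t. \<exists>K :: nat pair_pre_digraph. complete_digraph t (with_proj K) \<and> minor_of K G}"
    unfolding t_def hadwiger_number_def
    using hadwiger_set_finite hadwiger_set_nonempty by (intro Max_in) auto
  then obtain K :: "nat pair_pre_digraph" where K: "complete_digraph t (with_proj K)" "minor_of K G"
    by blast
  define I where "I = pverts K"
  have I: "finite I" "card I = t" and K_arcs: "\<And>x y. x \<in> I \<Longrightarrow> y \<in> I \<Longrightarrow> x \<noteq> y \<Longrightarrow> (x, y) \<in> parcs K"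
    using K(1) by (auto simp: complete_digraph_pair_def I_def)
  obtain B where B: "\<And>x. x \<in> I \<Longrightarrow> B x \<subseteq> pverts G"
      "\<And>x. x \<in> I \<Longrightarrow> connected (with_proj G \<restriction> B x)"
    and disj: "disjoint_family_on B I"
    and adj: "\<forall>(x, y) \<in> parcs K. \<exists>u \<in> B x. \<exists>v \<in> B y. (u, v) \<in> parcs G"
    using K(2) unfolding minor_of_def I_def by blast
  have adj': "parcs G \<inter> B x \<times> B y \<noteq> {}" if "x \<in> I" "y \<in> I" "x \<noteq> y" for x y
    using adj K_arcs[OF that] by blast
  have disj': "B x \<inter> B y = {}" if "x \<in> I" "y \<in> I" "x \<noteq> y" for x y
    using disj that by (auto simp: disjoint_family_on_def)
  have "card I choose 3 \<le> card (cycles_within (pverts G))"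
  proof (rule choose_le_card[OF finite_cycles_within I(1)])
    fix T assume T: "T \<subseteq> I" "card T = 3"
    then obtain x y z where xyz: "T = {x, y, z}" "x \<noteq> y" "x \<noteq> z" "y \<noteq> z"
      by (auto simp: card_3_iff)
    then have mem: "x \<in> I" "y \<in> I" "z \<in> I"
      using T by auto
    obtain U where U: "U \<in> cycles_within (B x \<union> B y \<union> B z)"
      "U \<inter> B x \<noteq> {}" "U \<inter> B y \<noteq> {}" "U \<inter> B z \<noteq> {}"
      using mem xyz B adj' disj'
      by (elim induced_cycle_three_sets[of "B x" "B y" "B z", rotated -1]) auto
    \<comment> \<open>The triple is recovered from \<open>U\<close> as the indices of the branch
      sets that it meets; disjointness rules out a fourth index.\<close>
    have "{i \<in> I. U \<inter> B i \<noteq> {}} \<subseteq> T"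
    proof
      fix i assume "i \<in> {i \<in> I. U \<inter> B i \<noteq> {}}"
      then have "i \<in> I" "B i \<inter> (B x \<union> B y \<union> B z) \<noteq> {}"
        using U(1) by auto
      then show "i \<in> T"
        using disj'[of i] mem xyz(1) by blast
    qed
    then have "{i \<in> I. U \<inter> B i \<noteq> {}} = T"
      using U(2-4) mem xyz(1) by blast
    moreover have "U \<in> cycles_within (pverts G)"
      using U(1) B(1) mem by blast
    ultimately show "\<exists>U \<in> cycles_within (pverts G). {i \<in> I. U \<inter> B i \<noteq> {}} = T"
      by blast
  qed
  then show ?thesis
    using card_cycles_within[of "pverts G"] I(2) by (simp add: t_def)
qed

section \<open>Colourings\<close>

text \<open>Colouring a vertex subset, not an induced subgraph, keeps \<open>G\<close> fixed during
  the induction.\<close>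

definition proper_colouring :: "'a set \<Rightarrow> nat \<Rightarrow> ('a \<Rightarrow> nat) \<Rightarrow> bool" where
  "proper_colouring S k c \<longleftrightarrow> c ` S \<subseteq> {..<k} \<and> (\<forall>(u, v) \<in> parcs G \<inter> S \<times> S. c u \<noteq> c v)"

lemma proper_colouring_pverts_iff: "(\<exists>c. proper_colouring (pverts G) k c) \<longleftrightarrow> colorable G k"
  unfolding proper_colouring_def colorable_def by (fastforce dest: in_arcsD1 in_arcsD2)

lemma proper_colouring_insert_fresh:
  assumes "proper_colouring S k c" "v \<notin> S"
  shows "proper_colouring (insert v S) (Suc k) (c(v := k))"
  unfolding proper_colouring_def
proof (intro conjI ballI)
  have c: "c w < k" if "w \<in> S" for w
    using assms(1) that by (auto simp: proper_colouring_def)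
  show "(c(v := k)) ` insert v S \<subseteq> {..<Suc k}"
    using c by (auto intro: less_SucI)
  fix e assume "e \<in> parcs G \<inter> insert v S \<times> insert v S"
  then obtain u w where e: "e = (u, w)" "(u, w) \<in> parcs G" "u \<in> insert v S" "w \<in> insert v S"
    by auto
  then have "u \<noteq> w"
    by (auto dest: no_loops')
  moreover have "c u \<noteq> c w" if "u \<in> S" "w \<in> S"
    using assms(1) e(2) that by (auto simp: proper_colouring_def)
  ultimately show "case e of (u, w) \<Rightarrow> (c(v := k)) u \<noteq> (c(v := k)) w"
    using e(1,3,4) c[of u] c[of w] by auto
qed

lemma Kempe_chain:
  assumes c: "proper_colouring S k c" and v: "v \<notin> S"
    and no: "\<nexists>c. proper_colouring (insert v S) k c"
    and ij: "i < k" "j < k" "i \<noteq> j"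
  defines "W \<equiv> {u \<in> S. c u \<in> {i, j}}"
  obtains x y where "x \<in> W" "c x = i" "(v, x) \<in> parcs G" "c y = j" "(v, y) \<in> parcs G"
    "(x, y) \<in> (parcs G \<inter> W \<times> W)\<^sup>*"
proof (rule ccontr)
  assume "\<not> thesis"
  \<comment> \<open>The negated goal as a rule: no chain contains neighbours of \<open>v\<close> of
    both colours.\<close>
  note none = that[THEN notE[OF this]]
  have swap: "(u, w) \<in> parcs G \<longleftrightarrow> (w, u) \<in> parcs G" for u w
    by (auto intro: arcs_symmetric)
  define X where "X = {x \<in> W. c x = i \<and> (v, x) \<in> parcs G}"
  \<comment> \<open>\<open>D\<close> is the union of the Kempe chains containing a neighbour of
    \<open>v\<close> of colour \<open>i\<close>; the colours are switched exactly there.\<close>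
  define D where "D = (parcs G \<inter> W \<times> W)\<^sup>* `` X"
  have "D \<subseteq> W"
    unfolding D_def using Image_closed_trancl[of "parcs G \<inter> W \<times> W" W] by (auto simp: X_def elim: rtranclE)
  have D_closed: "u \<in> D \<longleftrightarrow> w \<in> D" if "u \<in> W" "w \<in> W" "(u, w) \<in> parcs G" for u w
    unfolding D_def using that swap by (auto intro: rtrancl_into_rtrancl)
  have D_j: "(v, u) \<notin> parcs G" if "u \<in> D" "c u = j" for u
    using that none unfolding D_def X_def by blast
  define c' where "c' u = (if u = v then i else if u \<in> D then (if c u = i then j else i) else c u)" for u
  have c_neq: "c u \<noteq> c w" if "u \<in> S" "w \<in> S" "(u, w) \<in> parcs G" for u w
    using c that by (auto simp: proper_colouring_def)
  have W_iff: "u \<in> W \<longleftrightarrow> u \<in> S \<and> (c u = i \<or> c u = j)" for u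
    by (auto simp: W_def)
  have v_case: "c' w \<noteq> i" if "w \<in> S" "(v, w) \<in> parcs G" for w
  proof (cases "w \<in> D")
    case True
    then have "c w = i"
      using D_j that \<open>D \<subseteq> W\<close> W_iff by blast
    then show ?thesis
      using True ij v that by (auto simp: c'_def)
  next
    case False
    have "X \<subseteq> D"
      by (auto simp: D_def)
    then have "c w \<noteq> i"
      using False that W_iff by (auto simp: X_def)
    then show ?thesis
      using False v that by (auto simp: c'_def)
  qed
  have S_case: "c' u \<noteq> c' w" if "u \<in> S" "w \<in> S" "(u, w) \<in> parcs G" for u w
  proof -
    have "u \<noteq> v" "w \<noteq> v"
      using that v by auto
    moreover have "u \<in> D \<Longrightarrow> c u = i \<or> c u = j" "w \<in> D \<Longrightarrow> c w = i \<or> c w = j"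
      using \<open>D \<subseteq> W\<close> W_iff by blast+
    \<comment> \<open>An arc with both ends in \<open>W\<close> has both or neither end switched. If
      only one end has a colour in \<open>{i, j}\<close>, switching keeps that colour in
      \<open>{i, j}\<close> and the other end unchanged.\<close>
    moreover have "u \<in> D \<longleftrightarrow> w \<in> D" if "c u = i \<or> c u = j" "c w = i \<or> c w = j"
      using D_closed W_iff that \<open>u \<in> S\<close> \<open>w \<in> S\<close> \<open>(u, w) \<in> parcs G\<close> by blast
    ultimately show ?thesis
      using c_neq[OF that] ij unfolding c'_def by auto
  qed
  have "proper_colouring (insert v S) k c'"
    unfolding proper_colouring_def
  proof (intro conjI ballI)
    show "c' ` insert v S \<subseteq> {..<k}"
      using c ij by (auto simp: c'_def proper_colouring_def)
    fix e assume "e \<in> parcs G \<inter> insert v S \<times> insert v S"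
    then obtain u w where e: "e = (u, w)" "(u, w) \<in> parcs G" "u \<in> insert v S" "w \<in> insert v S"
      by auto
    moreover have "u \<noteq> w" "(w, u) \<in> parcs G"
      using e(2) swap by (auto dest: no_loops')
    moreover have "c' v = i"
      by (simp add: c'_def)
    ultimately show "case e of (u, w) \<Rightarrow> c' u \<noteq> c' w"
      using v_case[of u] v_case[of w] S_case[of u w] by auto
  qed
  then show False
    using no by blast
qed

lemma induced_cycle_two_colours:
  assumes S: "insert v S \<subseteq> pverts G" and c: "proper_colouring S k c" and v: "v \<notin> S"
    and no: "\<nexists>c. proper_colouring (insert v S) k c"
    and ij: "i < k" "j < k" "i \<noteq> j"
  obtains U where "U \<in> cycles_within (insert v S)" "v \<in> U" "c ` (U - {v}) = {i, j}"
proof -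
  define W where "W = {u \<in> S. c u \<in> {i, j}}"
  define N where "N l = {u. c u = l \<and> (v, u) \<in> parcs G}" for l
  obtain x y where xy: "x \<in> W" "x \<in> N i" "y \<in> N j" "(x, y) \<in> (parcs G \<inter> W \<times> W)\<^sup>*"
    using Kempe_chain[OF c v no ij] unfolding W_def N_def by blast
  obtain q where q: "q \<noteq> []" "induced_path (parcs G) q" "set q \<subseteq> W"
    "set q \<inter> N i = {hd q}" "set q \<inter> N j = {last q}"
    using induced_path_between[OF xy(4,1,2,3)] .
  have ends: "c (hd q) = i" "c (last q) = j"
    using q(4,5) by (auto simp: N_def)
  \<comment> \<open>The ends have different colours, so \<open>q\<close> together with
    \<open>v\<close> has the three vertices that a cycle needs.\<close>
  have len: "2 \<le> length q"
  proof (rule ccontr)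
    assume "\<not> 2 \<le> length q"
    then have "hd q = last q"
      using q(1) by (cases q; cases "tl q") auto
    then show False
      using ends ij(3) by simp
  qed
  have "v \<notin> set q"
    using q(3) v by (auto simp: W_def)
  have "set q \<inter> (N i \<union> N j) = {hd q, last q}"
    using q(4,5) by auto
  \<comment> \<open>All of \<open>q\<close> is coloured \<open>i\<close> or \<open>j\<close>, so
    each neighbour of \<open>v\<close> on it lies in \<open>N i\<close> or \<open>N j\<close> and is
    therefore an end of \<open>q\<close>.\<close>
  moreover have "parcs G \<inter> {v} \<times> set q = {v} \<times> (set q \<inter> (N i \<union> N j))"
    using q(3) by (auto simp: N_def W_def)
  ultimately have "parcs G \<inter> set [v] \<times> set q = {(last [v], hd q), (hd [v], last q)}"
    by auto
  then have "set [v] \<union> set q \<in> cycles_within (insert v S)"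
    using q S len \<open>v \<notin> set q\<close> by (intro induced_cycleI) (auto simp: W_def)
  moreover have "set [v] \<union> set q - {v} = set q"
    using \<open>v \<notin> set q\<close> by auto
  moreover have "c ` set q = {i, j}"
  proof
    show "c ` set q \<subseteq> {i, j}"
      using q(3) by (auto simp: W_def)
    have "hd q \<in> set q" "last q \<in> set q"
      using q(1) by auto
    then show "{i, j} \<subseteq> c ` set q"
      using ends by force
  qed
  ultimately show ?thesis
    by (intro that[of "set [v] \<union> set q"]) auto
qed

text \<open>Needing more than \<open>k\<close> colours means chromatic number at least
  \<open>Suc k\<close>, whence the binomial. Pascal's rule matches \<open>k choose 2\<close> with
  the cycles through the new vertex and \<open>k choose 3\<close> with those avoiding it.\<close>

lemma choose_le_card_cycles_within:
  assumes "finite S" "S \<subseteq> pverts G" "\<nexists>c. proper_colouring S k c"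
  shows "Suc k choose 3 \<le> card (cycles_within S)"
  using assms
proof (induction S arbitrary: k rule: finite_induct)
  case empty
  then show ?case by (simp add: proper_colouring_def)
next
  case (insert v S)
  show ?case
  proof (cases "\<exists>c. proper_colouring S k c")
    case False
    then have "Suc k choose 3 \<le> card (cycles_within S)"
      using insert by auto
    also have "\<dots> \<le> card (cycles_within (insert v S))"
      using finite_cycles_within by (intro card_mono) auto
    finally show ?thesis .
  next
    case True
    then obtain c where c: "proper_colouring S k c"
      by blast
    \<comment> \<open>Deleting one vertex saves at most one colour, so the induction hypothesis is
      used at \<open>k - 1\<close>; for \<open>k = 0\<close> the binomial vanishes.\<close>
    have smaller: "k choose 3 \<le> card (cycles_within S)"
    proof (cases k)
      case (Suc k')
      then have "\<nexists>c. proper_colouring S k' c"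
        using insert.prems insert.hyps proper_colouring_insert_fresh by blast
      then show ?thesis
        using insert Suc by auto
    qed (simp add: binomial_eq_0)
    define F where "F = {U \<in> cycles_within (insert v S). v \<in> U}"
    have finite_F: "finite F"
      unfolding F_def by (rule finite_subset[OF _ finite_cycles_within]) auto
    have "card {..<k} choose 2 \<le> card F"
    proof (rule choose_le_card)
      show "finite F"
        by (rule finite_F)
      fix T assume "T \<subseteq> {..<k}" "card T = 2"
      then obtain i j where "T = {i, j}" "i < k" "j < k" "i \<noteq> j"
        by (auto simp: card_2_iff)
      then show "\<exists>U \<in> F. c ` (U - {v}) = T"
        \<comment> \<open>\<open>c\<close> colours only \<open>S\<close>, so \<open>v\<close> is
          removed before the colours of the cycle are read off.\<close>
        using induced_cycle_two_colours[OF insert.prems(1) c insert.hyps(2) insert.prems(2)]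
        unfolding F_def by (metis (mono_tags, lifting) mem_Collect_eq)
    qed simp
    then have "Suc k choose 3 \<le> card (cycles_within S) + card F"
      using smaller by (simp add: numeral_eq_Suc)
    also have "\<dots> = card (cycles_within S \<union> F)"
      using insert.hyps(2)
      by (intro card_Un_disjoint[symmetric] finite_cycles_within finite_F) (auto simp: F_def)
    also have "\<dots> \<le> card (cycles_within (insert v S))"
      using finite_cycles_within by (intro card_mono) (auto simp: F_def)
    finally show ?thesis .
  qed
qed

lemma choose_chromatic_le: "chromatic_number G choose 3 \<le> card (induced_cycles G)"
proof (cases "chromatic_number G")
  case (Suc k)
  \<comment> \<open>\<open>k\<close> lies one below the least number of colours.\<close>
  then have "\<not> colorable G k"
    unfolding chromatic_number_def using not_less_Least by (metis lessI)
  then have "\<nexists>c. proper_colouring (pverts G) k c"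
    by (simp add: proper_colouring_pverts_iff)
  then have "Suc k choose 3 \<le> card (cycles_within (pverts G))"
    by (intro choose_le_card_cycles_within) auto
  then show ?thesis
    using card_cycles_within[of "pverts G"] Suc by simp
qed (simp add: binomial_eq_0)

end

theorem theorem5p1p1:
  fixes G :: "'a pair_pre_digraph" and n :: nat
  assumes "pair_graph G"
    and "connected (with_proj G)"
    and "0 < n"
    and "card (induced_cycles G) < n choose 3"
  shows "max (chromatic_number G) (hadwiger_number G) < n"
proof (rule ccontr)
  interpret pair_graph G by fact
  assume "\<not> ?thesis"
  then have "n \<le> max (chromatic_number G) (hadwiger_number G)"
    by (simp only: not_less)
  then have "n choose 3 \<le> max (chromatic_number G) (hadwiger_number G) choose 3"
    by (rule binomial_right_mono)
  \<comment> \<open>The maximum equals one of the two invariants, and the bound for that one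
    applies.\<close>
  also have "\<dots> \<le> card (induced_cycles G)"
    using choose_chromatic_le choose_hadwiger_le by (simp add: max_def)
  finally show False
    using assms(4) by simp
qed

end
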